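(* Let $\mathcal{C}$ be a sum closed permutation class with $f_n=|\mathcal{C}_n|$, $\widetilde f_n=|\oplus\mathcal{C}_n|$, and $g_n$ the number of sum-indecomposable permutations in $\mathcal{C}_n$. Let $G(x)=\sum_{n\ge1}g_nx^n$ with radius of convergence $r$, and let $\tau=\lim_{x\to r^-}G(x)$. Assume: - $\tau>1$ (supercritical, possibly $\tau=\infty$); - $G$ is aperiodic, i.e. there are no integers $s\ge0$ and $d\ge2$ and power series $H$ with $G(x)=x^sH(x^d)$. Let $\rho$ be the unique positive root of $G(x)=1$ (which is the radius of convergence of $F(x)=1/(1-G(x))$), and let $\alpha^{-1}=\rho G'(\rho)$. Then \[\widetilde f_n\sim\alpha^{-1}f_n\sim\rho^{-n}\qquad(n\to\infty).\]
   Context: A permutation class is a set of finite permutations closed under containment; $\mathcal{C}_n=\mathcal{C}\cap S_n$. The sum $\sigma\oplus\tau$ of $\sigma\in S_a$ and $\tau\in S_b$ equals $\sigma(i)$ for $i\le a$ and $a+\tau(i-a)$ for $i>a$. A class is sum closed if it is closed under $\oplus$. A permutation is sum-indecomposable if it is not a sum of two permutations of nonzero size; $F(x)=\sum f_nx^n=1/(1-G(x))$ with $f_0=1$. For $\pi\in S_n$, $\oplus\pi(i+kn)=\pi(i)+kn$ for $i\in[n]$ and $k\in\mathbb{Z}$. The shift is $\Sigma^r\sigma(i)=\sigma(i-r)+r$. We set $\oplus\mathcal{C}_n=\{\Sigma^r(\oplus\pi):\pi\in\mathcal{C}_n,\ r\in\mathbb{Z}\}$. *)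

theory Defs
  imports
    "HOL-Analysis.Analysis"
    "HOL-Combinatorics.Permutations"
    "HOL-Library.Landau_Symbols"
begin

text \<open>
  A finite permutation is a pair of its size and its underlying function.  The size has to be
  recorded because \<^term>\<open>p permutes {1..n}\<close> implies \<^term>\<open>p permutes {1..m}\<close> for all \<open>m \<ge> n\<close>.
\<close>

type_synonym fperm = "nat \<times> (nat \<Rightarrow> nat)"

definition perms :: "nat \<Rightarrow> fperm set" where
  "perms n = {(n, p) | p. p permutes {1..n}}"

definition contained_in :: "fperm \<Rightarrow> fperm \<Rightarrow> bool" where
  "contained_in \<sigma> \<pi> \<longleftrightarrow>
     (\<exists>e. strict_mono_on {1..fst \<sigma>} e \<and> e ` {1..fst \<sigma>} \<subseteq> {1..fst \<pi>} \<and>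
          (\<forall>i\<in>{1..fst \<sigma>}. \<forall>j\<in>{1..fst \<sigma>}. snd \<sigma> i < snd \<sigma> j \<longleftrightarrow> snd \<pi> (e i) < snd \<pi> (e j)))"

definition permutation_class :: "fperm set \<Rightarrow> bool" where
  "permutation_class C \<longleftrightarrow>
     C \<subseteq> (\<Union>n. perms n) \<and>
     (\<forall>\<pi>\<in>C. \<forall>\<sigma>\<in>(\<Union>n. perms n). contained_in \<sigma> \<pi> \<longrightarrow> \<sigma> \<in> C)"

definition perm_sum :: "fperm \<Rightarrow> fperm \<Rightarrow> fperm" where
  "perm_sum \<sigma> \<tau> = (fst \<sigma> + fst \<tau>,
     \<lambda>i. if i \<le> fst \<sigma> then snd \<sigma> i else fst \<sigma> + snd \<tau> (i - fst \<sigma>))"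

definition sum_closed :: "fperm set \<Rightarrow> bool" where
  "sum_closed C \<longleftrightarrow> (\<forall>\<sigma>\<in>C. \<forall>\<tau>\<in>C. perm_sum \<sigma> \<tau> \<in> C)"

definition sum_indecomposable :: "fperm \<Rightarrow> bool" where
  "sum_indecomposable \<pi> \<longleftrightarrow>
     \<not> (\<exists>a b. \<exists>\<sigma>\<in>perms a. \<exists>\<tau>\<in>perms b. a \<noteq> 0 \<and> b \<noteq> 0 \<and> \<pi> = perm_sum \<sigma> \<tau>)"

definition class_count :: "fperm set \<Rightarrow> nat \<Rightarrow> nat" where
  "class_count C n = card (C \<inter> perms n)"

definition indec_count :: "fperm set \<Rightarrow> nat \<Rightarrow> nat" where
  "indec_count C n = card {\<pi> \<in> C \<inter> perms n. sum_indecomposable \<pi>}"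

definition class_gf :: "fperm set \<Rightarrow> real fps" where
  "class_gf C = Abs_fps (\<lambda>n. real (class_count C n))"

text \<open>
  The empty permutation is vacuously sum-indecomposable, but the series starts at \<open>n = 1\<close>.
\<close>

definition indec_gf :: "fperm set \<Rightarrow> real fps" where
  "indec_gf C = Abs_fps (\<lambda>n. if n = 0 then 0 else real (indec_count C n))"

text \<open>
  The infinite sum \<open>\<oplus>\<pi>\<close> on the integers, obtained by writing the argument as \<open>i + k * n\<close> with
  \<open>1 \<le> i \<le> n\<close>; its defining property is \<open>infinite_sum_eq\<close> below.  The value for the
  empty permutation has no meaning.
\<close>

definition infinite_sum :: "fperm \<Rightarrow> int \<Rightarrow> int" where
  "infinite_sum \<pi> j =
     (let n = int (fst \<pi>); i = (j - 1) mod n + 1; k = (j - 1) div n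
      in int (snd \<pi> (nat i)) + k * n)"

lemma infinite_sum_eq:
  assumes "i \<in> {1..fst \<pi>}"
  shows "infinite_sum \<pi> (int i + k * int (fst \<pi>)) = int (snd \<pi> i) + k * int (fst \<pi>)"
proof -
  let ?n = "int (fst \<pi>)"
  have i: "0 \<le> int i - 1" "int i - 1 < ?n" using assms by auto
  have eq: "int i + k * ?n - 1 = (int i - 1) + k * ?n" by simp
  have "(int i + k * ?n - 1) mod ?n = int i - 1"
    unfolding eq using i by (simp only: mod_mult_self1 mod_pos_pos_trivial)
  moreover have "(int i + k * ?n - 1) div ?n = k"
    unfolding eq using i by simp
  ultimately show ?thesis by (simp add: infinite_sum_def)
qed

definition shift :: "int \<Rightarrow> (int \<Rightarrow> int) \<Rightarrow> int \<Rightarrow> int" where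
  "shift r \<sigma> i = \<sigma> (i - r) + r"

definition infinite_sum_class :: "fperm set \<Rightarrow> nat \<Rightarrow> (int \<Rightarrow> int) set" where
  "infinite_sum_class C n = {shift r (infinite_sum \<pi>) | \<pi> r. \<pi> \<in> C \<inter> perms n}"

definition infinite_sum_count :: "fperm set \<Rightarrow> nat \<Rightarrow> nat" where
  "infinite_sum_count C n = card (infinite_sum_class C n)"

definition aperiodic :: "real fps \<Rightarrow> bool" where
  "aperiodic G \<longleftrightarrow> \<not> (\<exists>(s::nat) (d::nat) (H::real fps). d \<ge> 2 \<and> G = fps_X ^ s * (H oo fps_X ^ d))"

end

(* Cutting a permutation after its first sum-indecomposable component gives F = 1 / (1 - G).
   Similarly, an infinite sum of period n is determined by a permutation of size n, which begins
   at the last cut at or before position 0, together with the offset of that cut, which is smaller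
   than the size k of the first component.  Hence the series counting infinite sums is
   x G'(x) F(x).

   The asymptotics is a renewal theorem for the distribution p_k = g_k \<rho>^k, whose generating
   function P has radius of convergence greater than 1 by supercriticality.  Writing
   1 - P = (1 - x) Q, the series Q still converges beyond the unit disc, has no zero in the closed
   disc by aperiodicity, and Q(1) = P'(1).  So 1 / Q also converges beyond the unit disc, and the
   coefficients of K / (1 - P) = (K / Q) / (1 - x) are partial sums that tend to K(1) / P'(1). *)

theory Submission
  imports Defs "HOL-Complex_Analysis.Complex_Analysis"
begin

section \<open>Finite permutations: cuts, and splitting as a sum\<close>

section \<open>Cuts and components\<close>

text \<open>Polymorphic, so that one notion serves finite permutations on \<open>nat\<close> and
  infinite sums on \<open>int\<close>.\<close>

definition is_cut :: "('a::linorder \<Rightarrow> 'a) \<Rightarrow> 'a \<Rightarrow> bool" where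
  "is_cut f a \<longleftrightarrow> (\<forall>i. f i \<le> a \<longleftrightarrow> i \<le> a)"

text \<open>The identity beyond \<open>a\<close> is what membership in \<open>perms a\<close>
  demands.\<close>

definition perm_take :: "nat \<Rightarrow> fperm \<Rightarrow> fperm" where
  "perm_take a \<pi> = (a, \<lambda>i. if i \<le> a then snd \<pi> i else i)"

text \<open>Truncated subtraction loses nothing at a cut, since positions beyond \<open>a\<close>
  then have values beyond \<open>a\<close>.\<close>

definition perm_drop :: "nat \<Rightarrow> fperm \<Rightarrow> fperm" where
  "perm_drop a \<pi> = (fst \<pi> - a, \<lambda>i. snd \<pi> (i + a) - a)"

text \<open>For a nonempty permutation this is the size of its first sum-indecomposable component;
  its full size is always a cut, so the minimum exists.\<close>

definition first_cut :: "fperm \<Rightarrow> nat" where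
  "first_cut \<pi> = (LEAST a. 0 < a \<and> is_cut (snd \<pi>) a)"

lemma perms_iff: "\<pi> \<in> perms n \<longleftrightarrow> fst \<pi> = n \<and> snd \<pi> permutes {1..n}"
  by (cases \<pi>) (auto simp: perms_def)

lemma finite_perms [simp]: "finite (perms n)"
proof -
  have "perms n = Pair n ` {p. p permutes {1..n}}"
    by (auto simp: perms_def)
  then show ?thesis
    by (simp add: finite_permutations)
qed

lemma perms_0: "perms 0 = {(0, id)}"
  by (auto simp: perms_def)

lemma permutes_outside:
  assumes "\<pi> \<in> perms n" and "i = 0 \<or> n < i"
  shows "snd \<pi> i = i"
  using assms by (auto simp: perms_iff permutes_def)

lemma permutes_range:
  assumes "\<pi> \<in> perms n" and "0 < i" and "i \<le> n"
  shows "0 < snd \<pi> i" and "snd \<pi> i \<le> n"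
  using permutes_in_image[of "snd \<pi>" "{1..n}" i] assms by (auto simp: perms_iff)

lemma perms_inj:
  assumes "\<pi> \<in> perms n"
  shows "snd \<pi> i = snd \<pi> j \<longleftrightarrow> i = j"
  using assms permutes_inj[of "snd \<pi>" "{1..n}"] by (auto simp: perms_iff inj_eq)

lemma is_cut_0:
  assumes "\<pi> \<in> perms n"
  shows "is_cut (snd \<pi>) 0"
  unfolding is_cut_def
proof
  fix i
  show "snd \<pi> i \<le> 0 \<longleftrightarrow> i \<le> 0"
    using permutes_outside[OF assms, of i] permutes_range[OF assms, of i]
    by (cases "i = 0 \<or> n < i") auto
qed

lemma cut_ge_size:
  assumes "\<pi> \<in> perms n" and "n \<le> a"
  shows "is_cut (snd \<pi>) a"
  unfolding is_cut_def
proof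
  fix i
  show "snd \<pi> i \<le> a \<longleftrightarrow> i \<le> a"
    using permutes_outside[OF assms(1), of i] permutes_range[OF assms(1), of i] assms(2)
    by (cases "i = 0 \<or> n < i") auto
qed

lemma first_cut:
  assumes "\<pi> \<in> perms n" and "0 < n"
  shows "0 < first_cut \<pi>" and "is_cut (snd \<pi>) (first_cut \<pi>)" and "first_cut \<pi> \<le> n"
proof -
  have "0 < n \<and> is_cut (snd \<pi>) n"
    using cut_ge_size assms by blast
  from LeastI[of "\<lambda>a. 0 < a \<and> is_cut (snd \<pi>) a", OF this]
    Least_le[of "\<lambda>a. 0 < a \<and> is_cut (snd \<pi>) a", OF this]
  show "0 < first_cut \<pi>" "is_cut (snd \<pi>) (first_cut \<pi>)" "first_cut \<pi> \<le> n"
    by (auto simp: first_cut_def)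
qed

lemma first_cut_le: "0 < a \<Longrightarrow> is_cut (snd \<pi>) a \<Longrightarrow> first_cut \<pi> \<le> a"
  unfolding first_cut_def by (rule Least_le) simp

lemma perm_sum_in_perms:
  assumes "\<sigma> \<in> perms a" and "\<tau> \<in> perms b"
  shows "perm_sum \<sigma> \<tau> \<in> perms (a + b)"
proof -
  let ?p = "snd (perm_sum \<sigma> \<tau>)"
  have fst: "fst \<sigma> = a" "fst \<tau> = b"
    using assms by (auto simp: perms_iff)
  have \<sigma>: "snd \<sigma> i \<le> a \<longleftrightarrow> i \<le> a" for i
    using cut_ge_size[OF assms(1) order_refl] by (auto simp: is_cut_def)
  have "?p permutes {1..a + b}"
  proof (rule bij_imp_permutes)
    have sub: "?p ` {1..a + b} \<subseteq> {1..a + b}"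
    proof
      fix y assume "y \<in> ?p ` {1..a + b}"
      then obtain i where i: "0 < i" "i \<le> a + b" "y = ?p i"
        by (auto simp: Suc_le_eq)
      then have "i - a \<le> b"
        by simp
      then show "y \<in> {1..a + b}"
        using i permutes_range[OF assms(1), of i] permutes_range[OF assms(2), of "i - a"]
        by (cases "i \<le> a") (auto simp: perm_sum_def fst Suc_le_eq)
    qed
    have inj: "inj_on ?p {1..a + b}"
    proof (rule inj_onI)
      fix i j assume ij: "i \<in> {1..a + b}" "j \<in> {1..a + b}" "?p i = ?p j"
      \<comment> \<open>Hence the values of the second block exceed \<open>a\<close> and never meet
        those of the first.\<close>
      have *: "0 < snd \<tau> (k - a)" if "k \<in> {1..a + b}" "\<not> k \<le> a" for k
        using permutes_range[OF assms(2), of "k - a"] that by auto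
      show "i = j"
        using ij *[of i] *[of j] \<sigma>[of i] \<sigma>[of j] perms_inj[OF assms(1), of i j]
          perms_inj[OF assms(2), of "i - a" "j - a"]
        by (cases "i \<le> a"; cases "j \<le> a") (auto simp: perm_sum_def fst)
    qed
    show "bij_betw ?p {1..a + b} {1..a + b}"
      using endo_inj_surj[OF _ sub inj] inj by (auto simp: bij_betw_def)
    fix i assume "i \<notin> {1..a + b}"
    then show "?p i = i"
      using permutes_outside[OF assms(1), of i] permutes_outside[OF assms(2), of "i - a"]
      by (cases "i = 0") (auto simp: perm_sum_def fst)
  qed
  then show ?thesis
    by (simp add: perms_iff) (simp add: perm_sum_def fst)
qed

lemma perm_take_in_perms:
  assumes "\<pi> \<in> perms n" and "is_cut (snd \<pi>) a"
  shows "perm_take a \<pi> \<in> perms a"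
proof -
  let ?p = "snd (perm_take a \<pi>)"
  have "?p permutes {1..a}"
  proof (rule bij_imp_permutes)
    have sub: "?p ` {1..a} \<subseteq> {1..a}"
    proof
      fix y assume "y \<in> ?p ` {1..a}"
      then obtain i where i: "0 < i" "i \<le> a" "y = snd \<pi> i"
        by (auto simp: Suc_le_eq perm_take_def)
      then show "y \<in> {1..a}"
        using assms(2) permutes_range[OF assms(1), of i] permutes_outside[OF assms(1), of i]
        by (cases "i \<le> n") (auto simp: is_cut_def)
    qed
    have inj: "inj_on ?p {1..a}"
      by (rule inj_onI) (auto simp: perm_take_def perms_inj[OF assms(1)])
    show "bij_betw ?p {1..a} {1..a}"
      using endo_inj_surj[OF _ sub inj] inj by (auto simp: bij_betw_def)
    fix i assume "i \<notin> {1..a}"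
    then show "?p i = i"
      using permutes_outside[OF assms(1), of i] by (cases "i = 0") (auto simp: perm_take_def)
  qed
  then show ?thesis
    by (simp add: perms_iff) (simp add: perm_take_def)
qed

lemma perm_drop_in_perms:
  assumes "\<pi> \<in> perms n" and "is_cut (snd \<pi>) a" and "a \<le> n"
  shows "perm_drop a \<pi> \<in> perms (n - a)"
proof -
  let ?p = "snd (perm_drop a \<pi>)"
  have gt: "a < snd \<pi> (i + a)" if "0 < i" for i
    using assms(2) that by (metis is_cut_def add_le_same_cancel2 not_le)
  have "?p permutes {1..n - a}"
  proof (rule bij_imp_permutes)
    have sub: "?p ` {1..n - a} \<subseteq> {1..n - a}"
    proof
      fix y assume "y \<in> ?p ` {1..n - a}"
      then obtain i where i: "0 < i" "i \<le> n - a" "y = snd \<pi> (i + a) - a"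
        by (auto simp: Suc_le_eq perm_drop_def)
      moreover have "i + a \<le> n"
        using i assms(3) by simp
      ultimately show "y \<in> {1..n - a}"
        using gt[of i] permutes_range[OF assms(1), of "i + a"] by auto
    qed
    have inj: "inj_on ?p {1..n - a}"
    proof (rule inj_onI)
      fix i j assume "i \<in> {1..n - a}" "j \<in> {1..n - a}" "?p i = ?p j"
      then show "i = j"
        using gt[of i] gt[of j] perms_inj[OF assms(1), of "i + a" "j + a"]
        by (auto simp: perm_drop_def)
    qed
    show "bij_betw ?p {1..n - a} {1..n - a}"
      using endo_inj_surj[OF _ sub inj] inj by (auto simp: bij_betw_def)
    fix i assume i: "i \<notin> {1..n - a}"
    show "?p i = i"
    proof (cases "i = 0")
      case True
      then show ?thesis
        using assms(2) by (auto simp: perm_drop_def is_cut_def)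
    next
      case False
      then show ?thesis
        using i assms(3) permutes_outside[OF assms(1), of "i + a"] by (auto simp: perm_drop_def)
    qed
  qed
  then show ?thesis
    using assms(1) by (simp add: perms_iff) (simp add: perm_drop_def)
qed

lemma perm_sum_take_drop:
  assumes "\<pi> \<in> perms n" and "is_cut (snd \<pi>) a" and "a \<le> n"
  shows "perm_sum (perm_take a \<pi>) (perm_drop a \<pi>) = \<pi>"
proof (rule prod_eqI)
  show "fst (perm_sum (perm_take a \<pi>) (perm_drop a \<pi>)) = fst \<pi>"
    using assms by (simp add: perm_sum_def perm_take_def perm_drop_def perms_iff)
  show "snd (perm_sum (perm_take a \<pi>) (perm_drop a \<pi>)) = snd \<pi>"
  proof
    fix i
    have "a \<le> snd \<pi> i" if "\<not> i \<le> a"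
      using assms(2) that by (metis is_cut_def nle_le)
    then show "snd (perm_sum (perm_take a \<pi>) (perm_drop a \<pi>)) i = snd \<pi> i"
      by (auto simp: perm_sum_def perm_take_def perm_drop_def)
  qed
qed

lemma perm_take_sum:
  assumes "\<sigma> \<in> perms a"
  shows "perm_take a (perm_sum \<sigma> \<tau>) = \<sigma>"
  using assms permutes_outside[OF assms]
  by (intro prod_eqI) (auto simp: perm_sum_def perm_take_def perms_iff)

lemma perm_drop_sum:
  assumes "\<sigma> \<in> perms a" and "\<tau> \<in> perms b"
  shows "perm_drop a (perm_sum \<sigma> \<tau>) = \<tau>"
proof (rule prod_eqI)
  show "fst (perm_drop a (perm_sum \<sigma> \<tau>)) = fst \<tau>"
    using assms by (simp add: perm_sum_def perm_drop_def perms_iff)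
  show "snd (perm_drop a (perm_sum \<sigma> \<tau>)) = snd \<tau>"
  proof
    fix i
    \<comment> \<open>This settles position 0, where \<open>perm_drop\<close> returns the truncated
      difference of this value and \<open>a\<close>.\<close>
    have "snd \<sigma> a \<le> a"
      using cut_ge_size[OF assms(1) order_refl] by (simp add: is_cut_def)
    then show "snd (perm_drop a (perm_sum \<sigma> \<tau>)) i = snd \<tau> i"
      using assms permutes_outside[OF assms(2), of 0]
      by (cases "i = 0") (auto simp: perm_sum_def perm_drop_def perms_iff)
  qed
qed

text \<open>The sum agrees with \<open>\<sigma>\<close> up to position \<open>a\<close>. Beyond it,
  \<open>\<sigma>\<close> is the identity and the sum has values above \<open>a\<close>, so neither
  reaches \<open>c\<close> or less.\<close>

lemma cut_perm_sum_le:
  assumes "\<sigma> \<in> perms a" and "\<tau> \<in> perms b" and "c \<le> a"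
  shows "is_cut (snd (perm_sum \<sigma> \<tau>)) c \<longleftrightarrow> is_cut (snd \<sigma>) c"
proof -
  have "snd (perm_sum \<sigma> \<tau>) i \<le> c \<longleftrightarrow> snd \<sigma> i \<le> c" for i
  proof (cases "i \<le> a")
    case False
    then have "snd \<sigma> i = i" "0 < snd \<tau> (i - a)"
      using permutes_outside[OF assms(1), of i] permutes_range[OF assms(2), of "i - a"]
        permutes_outside[OF assms(2), of "i - a"]
      by (simp, cases "i - a \<le> b") (use False in \<open>auto simp: Suc_le_eq\<close>)
    then show ?thesis
      using assms False by (auto simp: perm_sum_def perms_iff)
  qed (use assms in \<open>auto simp: perm_sum_def perms_iff\<close>)
  then show ?thesis
    by (simp add: is_cut_def)
qed

text \<open>Interior cuts are the places where a permutation splits: taking and dropping there gives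
  two nonempty summands, and conversely the size of the first summand is a cut.\<close>

lemma sum_indecomposable_iff:
  assumes "\<pi> \<in> perms n"
  shows "sum_indecomposable \<pi> \<longleftrightarrow> (\<forall>a. 0 < a \<longrightarrow> a < n \<longrightarrow> \<not> is_cut (snd \<pi>) a)"
proof
  assume *: "sum_indecomposable \<pi>"
  show "\<forall>a. 0 < a \<longrightarrow> a < n \<longrightarrow> \<not> is_cut (snd \<pi>) a"
  proof (intro allI impI notI)
    fix a assume a: "0 < a" "a < n" "is_cut (snd \<pi>) a"
    then have "\<pi> = perm_sum (perm_take a \<pi>) (perm_drop a \<pi>)"
      using perm_sum_take_drop[OF assms] by simp
    moreover have "perm_take a \<pi> \<in> perms a" "perm_drop a \<pi> \<in> perms (n - a)"
      using perm_take_in_perms[OF assms] perm_drop_in_perms[OF assms] a by auto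
    moreover have "a \<noteq> 0" "n - a \<noteq> 0"
      using a by auto
    ultimately show False
      using * unfolding sum_indecomposable_def by blast
  qed
next
  assume *: "\<forall>a. 0 < a \<longrightarrow> a < n \<longrightarrow> \<not> is_cut (snd \<pi>) a"
  show "sum_indecomposable \<pi>"
    unfolding sum_indecomposable_def
  proof (rule notI, elim exE bexE conjE)
    fix a b \<sigma> \<tau>
    assume h: "\<sigma> \<in> perms a" "\<tau> \<in> perms b" "a \<noteq> 0" "b \<noteq> 0" "\<pi> = perm_sum \<sigma> \<tau>"
    have "n = a + b"
      using perm_sum_in_perms[OF h(1,2)] assms h(5) by (simp add: perms_iff)
    moreover have "is_cut (snd \<pi>) a"
      using cut_perm_sum_le[OF h(1,2)] cut_ge_size[OF h(1)] h(5) by simp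
    ultimately show False
      using * h by auto
  qed
qed

text \<open>Below \<open>k\<close> the sum has the same cuts as \<open>\<beta>\<close>, and
  \<open>k\<close> itself is a cut. So it is the first one exactly when \<open>\<beta>\<close> has
  no interior cut.\<close>

lemma first_cut_perm_sum:
  assumes "\<beta> \<in> perms k" and "0 < k" and "\<gamma> \<in> perms m"
  shows "first_cut (perm_sum \<beta> \<gamma>) = k \<longleftrightarrow> sum_indecomposable \<beta>"
proof -
  let ?\<pi> = "perm_sum \<beta> \<gamma>"
  have cut: "is_cut (snd ?\<pi>) c \<longleftrightarrow> is_cut (snd \<beta>) c" if "c \<le> k" for c
    using cut_perm_sum_le assms that by blast
  have k: "is_cut (snd ?\<pi>) k"
    using cut[of k] cut_ge_size[OF assms(1)] by simp
  have "first_cut ?\<pi> = k \<longleftrightarrow> (\<forall>a. 0 < a \<longrightarrow> a < k \<longrightarrow> \<not> is_cut (snd ?\<pi>) a)"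
  proof
    assume *: "first_cut ?\<pi> = k"
    show "\<forall>a. 0 < a \<longrightarrow> a < k \<longrightarrow> \<not> is_cut (snd ?\<pi>) a"
    proof (intro allI impI notI)
      fix a assume "0 < a" "a < k" "is_cut (snd ?\<pi>) a"
      then show False
        using first_cut_le[of a ?\<pi>] * by simp
    qed
  next
    assume "\<forall>a. 0 < a \<longrightarrow> a < k \<longrightarrow> \<not> is_cut (snd ?\<pi>) a"
    with k assms(2) show "first_cut ?\<pi> = k"
      unfolding first_cut_def by (intro Least_equality) (auto simp: not_less[symmetric])
  qed
  then show ?thesis
    using cut sum_indecomposable_iff[OF assms(1)] by auto
qed

section \<open>Sum closed classes, counted by first component\<close>

locale sum_closed_class =
  fixes C :: "fperm set"
  assumes permutation_class: "permutation_class C"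
    and sum_closed: "sum_closed C"
begin

lemma perm_take_in_class:
  assumes "\<pi> \<in> C \<inter> perms n" and "is_cut (snd \<pi>) a" and "a \<le> n"
  shows "perm_take a \<pi> \<in> C \<inter> perms a"
proof -
  have "perm_take a \<pi> \<in> perms a"
    using perm_take_in_perms[of \<pi> n a] assms by auto
  moreover have "contained_in (perm_take a \<pi>) \<pi>"
    unfolding contained_in_def
    by (rule exI[of _ id]) (use assms in \<open>auto simp: strict_mono_on_def perm_take_def perms_iff\<close>)
  ultimately show ?thesis
    using permutation_class assms(1) unfolding permutation_class_def by blast
qed

lemma perm_drop_in_class:
  assumes "\<pi> \<in> C \<inter> perms n" and "is_cut (snd \<pi>) a" and "a \<le> n"
  shows "perm_drop a \<pi> \<in> C \<inter> perms (n - a)"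
proof -
  \<comment> \<open>With both values above \<open>a\<close>, truncated subtraction preserves their
    order.\<close>
  have *: "a < snd \<pi> (i + a)" if "0 < i" for i
    using assms(2) that by (metis is_cut_def add_le_same_cancel2 not_le)
  have "perm_drop a \<pi> \<in> perms (n - a)"
    using perm_drop_in_perms[of \<pi> n a] assms by auto
  moreover have "contained_in (perm_drop a \<pi>) \<pi>"
    unfolding contained_in_def
  proof (intro exI[of _ "\<lambda>i. i + a"] conjI ballI)
    fix i j assume "i \<in> {1..fst (perm_drop a \<pi>)}" "j \<in> {1..fst (perm_drop a \<pi>)}"
    then show "snd (perm_drop a \<pi>) i < snd (perm_drop a \<pi>) j \<longleftrightarrow> snd \<pi> (i + a) < snd \<pi> (j + a)"
      using *[of i] *[of j] by (auto simp: perm_drop_def)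
  qed (use assms in \<open>auto simp: strict_mono_on_def perm_drop_def perms_iff\<close>)
  ultimately show ?thesis
    using permutation_class assms(1) unfolding permutation_class_def by blast
qed

lemma perm_sum_in_class:
  assumes "\<sigma> \<in> C \<inter> perms a" and "\<tau> \<in> C \<inter> perms b"
  shows "perm_sum \<sigma> \<tau> \<in> C \<inter> perms (a + b)"
  using assms sum_closed perm_sum_in_perms[of \<sigma> a \<tau> b] by (auto simp: sum_closed_def)

text \<open>Cutting at \<open>k\<close> and forming the sum are mutually inverse. Closure under
  containment keeps both pieces in the class, and sum closure brings their sum back.\<close>

lemma card_first_cut_eq:
  assumes "0 < k" and "k \<le> n"
  shows "card {\<pi> \<in> C \<inter> perms n. first_cut \<pi> = k} = indec_count C k * class_count C (n - k)"
proof -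
  let ?B = "{\<pi> \<in> C \<inter> perms k. sum_indecomposable \<pi>}"
  have "bij_betw (\<lambda>(\<beta>, \<gamma>). perm_sum \<beta> \<gamma>) (?B \<times> (C \<inter> perms (n - k)))
      {\<pi> \<in> C \<inter> perms n. first_cut \<pi> = k}"
  proof (rule bij_betw_byWitness[where f' = "\<lambda>\<pi>. (perm_take k \<pi>, perm_drop k \<pi>)"])
    show "\<forall>x\<in>?B \<times> (C \<inter> perms (n - k)).
        (\<lambda>\<pi>. (perm_take k \<pi>, perm_drop k \<pi>)) (case x of (\<beta>, \<gamma>) \<Rightarrow> perm_sum \<beta> \<gamma>) = x"
      using perm_take_sum perm_drop_sum by auto
    have *: "is_cut (snd \<pi>) k" if "\<pi> \<in> C \<inter> perms n" "first_cut \<pi> = k" for \<pi>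
      using first_cut(2)[of \<pi> n] that assms by auto
    then show "\<forall>\<pi>\<in>{\<pi> \<in> C \<inter> perms n. first_cut \<pi> = k}.
        (case (perm_take k \<pi>, perm_drop k \<pi>) of (\<beta>, \<gamma>) \<Rightarrow> perm_sum \<beta> \<gamma>) = \<pi>"
      using perm_sum_take_drop assms by auto
    show "(\<lambda>(\<beta>, \<gamma>). perm_sum \<beta> \<gamma>) ` (?B \<times> (C \<inter> perms (n - k)))
        \<subseteq> {\<pi> \<in> C \<inter> perms n. first_cut \<pi> = k}"
    proof (rule image_subsetI, elim SigmaE)
      fix x \<beta> \<gamma> assume "\<beta> \<in> ?B" "\<gamma> \<in> C \<inter> perms (n - k)" "x = (\<beta>, \<gamma>)"
      then show "(case x of (\<beta>, \<gamma>) \<Rightarrow> perm_sum \<beta> \<gamma>) \<in> {\<pi> \<in> C \<inter> perms n. first_cut \<pi> = k}"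
        using perm_sum_in_class[of \<beta> k \<gamma> "n - k"] first_cut_perm_sum[of \<beta> k \<gamma>] assms by auto
    qed
    show "(\<lambda>\<pi>. (perm_take k \<pi>, perm_drop k \<pi>)) ` {\<pi> \<in> C \<inter> perms n. first_cut \<pi> = k}
        \<subseteq> ?B \<times> (C \<inter> perms (n - k))"
    proof (rule image_subsetI)
      fix \<pi> assume "\<pi> \<in> {\<pi> \<in> C \<inter> perms n. first_cut \<pi> = k}"
      then have h: "\<pi> \<in> C" "\<pi> \<in> perms n" "k = first_cut \<pi>"
        by auto
      then have c: "is_cut (snd \<pi>) k"
        using * by auto
      have t: "perm_take k \<pi> \<in> C \<inter> perms k" and d: "perm_drop k \<pi> \<in> C \<inter> perms (n - k)"
        using perm_take_in_class perm_drop_in_class h c assms by auto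
      have "sum_indecomposable (perm_take k \<pi>)"
        using first_cut_perm_sum[of "perm_take k \<pi>" k "perm_drop k \<pi>"] t d assms h
          perm_sum_take_drop[OF h(2) c assms(2)] by auto
      with t d show "(perm_take k \<pi>, perm_drop k \<pi>) \<in> ?B \<times> (C \<inter> perms (n - k))"
        by auto
    qed
  qed
  from bij_betw_same_card[OF this] show ?thesis
    by (simp add: card_cartesian_product indec_count_def class_count_def)
qed

text \<open>The weight serves two counts: \<open>w k = 1\<close> gives the recursion for the class,
  and \<open>w k = k\<close> the number of infinite sums.\<close>

lemma sum_over_first_cut:
  fixes w :: "nat \<Rightarrow> nat"
  assumes "0 < n"
  shows "(\<Sum>\<pi>\<in>C \<inter> perms n. w (first_cut \<pi>)) =
    (\<Sum>k=1..n. w k * (indec_count C k * class_count C (n - k)))"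
proof -
  have "(\<Sum>\<pi>\<in>C \<inter> perms n. w (first_cut \<pi>)) =
      (\<Sum>k=1..n. \<Sum>\<pi>\<in>{\<pi> \<in> C \<inter> perms n. first_cut \<pi> = k}. w (first_cut \<pi>))"
    by (rule sum.group[symmetric]) (use first_cut assms in \<open>auto simp: Suc_le_eq\<close>)
  also have "\<dots> = (\<Sum>k=1..n. w k * card {\<pi> \<in> C \<inter> perms n. first_cut \<pi> = k})"
    by (intro sum.cong) auto
  finally show ?thesis
    using card_first_cut_eq by simp
qed

lemma class_count_rec:
  assumes "0 < n"
  shows "class_count C n = (\<Sum>k=1..n. indec_count C k * class_count C (n - k))"
  using sum_over_first_cut[OF assms, of "\<lambda>_. 1"] by (simp add: class_count_def)

text \<open>The empty permutation is contained in every member.\<close>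

lemma class_count_0:
  assumes "C \<noteq> {}"
  shows "class_count C 0 = 1"
proof -
  obtain \<pi> where "\<pi> \<in> C"
    using assms by auto
  moreover have "contained_in (0, id) \<pi>"
    by (auto simp: contained_in_def strict_mono_on_def)
  ultimately have "(0, id) \<in> C"
    using permutation_class perms_0 unfolding permutation_class_def by blast
  then show ?thesis
    by (simp add: class_count_def perms_0)
qed

end

section \<open>Infinite sums: periodicity, cuts and rotation\<close>

section \<open>Infinite sums\<close>

lemma infinite_sum_add_period:
  assumes "\<pi> \<in> perms n" and "0 < n"
  shows "infinite_sum \<pi> (x + k * int n) = infinite_sum \<pi> x + k * int n"
proof -
  have "(x + k * int n - 1) mod int n = (x - 1) mod int n"
    by (simp add: diff_add_eq[symmetric])
  moreover have "(x + k * int n - 1) div int n = (x - 1) div int n + k"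
    using assms(2) by (simp add: diff_add_eq[symmetric])
  ultimately show ?thesis
    using assms by (simp add: infinite_sum_def perms_iff Let_def algebra_simps)
qed

text \<open>Residues run from 1 to \<open>n\<close>, which is the form that
  \<open>infinite_sum_eq\<close> accepts.\<close>

lemma residue_cases:
  fixes x :: int
  assumes "0 < n"
  obtains i k where "0 < i" "i \<le> n" "x = int i + k * int n"
proof
  let ?i = "(x - 1) mod int n + 1"
  have i: "0 \<le> (x - 1) mod int n" "(x - 1) mod int n < int n"
    using assms by auto
  then show "0 < nat ?i" "nat ?i \<le> n"
    by linarith+
  show "x = int (nat ?i) + (x - 1) div int n * int n"
    using i div_mult_mod_eq[of "x - 1" "int n"] by simp
qed

text \<open>Only the block \<open>k = 0\<close> matters: in earlier blocks positions and values are
  at most 0, in later ones both exceed \<open>n\<close> and hence \<open>a\<close>.\<close>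

lemma cut_infinite_sum:
  assumes "\<pi> \<in> perms n" and "0 < n" and "a \<le> n"
  shows "is_cut (infinite_sum \<pi>) (int a) \<longleftrightarrow> is_cut (snd \<pi>) a"
proof
  have eq: "infinite_sum \<pi> (int i + k * int n) = int (snd \<pi> i) + k * int n"
    if "0 < i" "i \<le> n" for i k
    using infinite_sum_eq[of i \<pi> k] that assms by (simp add: perms_iff)
  show "is_cut (snd \<pi>) a" if *: "is_cut (infinite_sum \<pi>) (int a)"
    unfolding is_cut_def
  proof
    fix i
    show "snd \<pi> i \<le> a \<longleftrightarrow> i \<le> a"
    proof (cases "i = 0 \<or> n < i")
      case False
      then show ?thesis
        using eq[of i 0] *[unfolded is_cut_def, rule_format, of "int i"] by simp
    qed (use permutes_outside[OF assms(1)] in auto)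
  qed
  show "is_cut (infinite_sum \<pi>) (int a)" if *: "is_cut (snd \<pi>) a"
    unfolding is_cut_def
  proof
    fix x
    obtain i k where x: "0 < i" "i \<le> n" "x = int i + k * int n"
      using residue_cases[OF assms(2)] .
    note i = permutes_range[OF assms(1) x(1,2)]
    consider "k = 0" | "k \<le> -1" | "1 \<le> k"
      by linarith
    then show "infinite_sum \<pi> x \<le> int a \<longleftrightarrow> x \<le> int a"
    proof cases
      case 1
      then show ?thesis
        using * x eq[of i 0] by (simp add: is_cut_def)
    next
      case 2
      then have "k * int n \<le> (-1) * int n"
        by (intro mult_right_mono) auto
      moreover have "infinite_sum \<pi> x = int (snd \<pi> i) + k * int n"
        using x eq by simp
      ultimately show ?thesis
        using x i by linarith
    next
      case 3
      then have "1 * int n \<le> k * int n"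
        by (intro mult_right_mono) auto
      moreover have "infinite_sum \<pi> x = int (snd \<pi> i) + k * int n"
        using x eq by simp
      ultimately show ?thesis
        using x i assms(3) by linarith
    qed
  qed
qed

lemma cut_shift: "is_cut (shift r f) a \<longleftrightarrow> is_cut f (a - r)"
proof
  assume *: "is_cut (shift r f) a"
  show "is_cut f (a - r)"
    unfolding is_cut_def
  proof
    fix i
    show "f i \<le> a - r \<longleftrightarrow> i \<le> a - r"
      using *[unfolded is_cut_def, rule_format, of "i + r"] by (auto simp: shift_def)
  qed
next
  assume *: "is_cut f (a - r)"
  show "is_cut (shift r f) a"
    unfolding is_cut_def
  proof
    fix i
    show "shift r f i \<le> a \<longleftrightarrow> i \<le> a"
      using *[unfolded is_cut_def, rule_format, of "i - r"] by (auto simp: shift_def)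
  qed
qed

lemma shift_shift: "shift a (shift b f) = shift (a + b) f"
  by (rule ext) (simp add: shift_def algebra_simps)

lemma shift_infinite_sum_period:
  assumes "\<pi> \<in> perms n" and "0 < n"
  shows "shift (r + k * int n) (infinite_sum \<pi>) = shift r (infinite_sum \<pi>)"
proof
  fix x
  show "shift (r + k * int n) (infinite_sum \<pi>) x = shift r (infinite_sum \<pi>) x"
    using infinite_sum_add_period[OF assms, of "x - r" "- k"] by (simp add: shift_def algebra_simps)
qed

text \<open>The block \<open>k = 0\<close> of the infinite sum is the permutation itself. The common
  size is essential: a nonempty \<open>\<pi>\<close> and its sum with itself have the same infinite
  sum.\<close>

lemma infinite_sum_inj:
  assumes "\<pi> \<in> perms n" and "\<pi>' \<in> perms n" and "infinite_sum \<pi> = infinite_sum \<pi>'"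
  shows "\<pi> = \<pi>'"
proof (rule prod_eqI)
  show "fst \<pi> = fst \<pi>'"
    using assms by (simp add: perms_iff)
  show "snd \<pi> = snd \<pi>'"
  proof
    fix i
    show "snd \<pi> i = snd \<pi>' i"
    proof (cases "i = 0 \<or> n < i")
      case False
      then show ?thesis
        using infinite_sum_eq[of i \<pi> 0] infinite_sum_eq[of i \<pi>' 0] assms by (simp add: perms_iff)
    qed (use permutes_outside assms in auto)
  qed
qed

text \<open>Exchanging the two pieces at a cut moves the origin of the infinite sum to that cut. By
  periodicity it suffices to compare one period.\<close>

lemma infinite_sum_rotate:
  assumes "\<pi> \<in> perms n" and "0 < n" and "is_cut (snd \<pi>) a" and "a \<le> n"
  shows "infinite_sum (perm_sum (perm_drop a \<pi>) (perm_take a \<pi>)) = shift (- int a) (infinite_sum \<pi>)"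
    (is "infinite_sum ?\<pi>' = _")
proof
  fix x
  have fst_\<pi>: "fst \<pi> = n"
    using assms(1) by (simp add: perms_iff)
  have \<pi>': "?\<pi>' \<in> perms n"
    using perm_sum_in_perms[OF perm_drop_in_perms[OF assms(1,3,4)] perm_take_in_perms[OF assms(1,3)]]
      assms(4) by simp
  obtain i k where x: "0 < i" "i \<le> n" "x = int i + k * int n"
    using residue_cases[OF assms(2)] .
  have "infinite_sum ?\<pi>' (int i) = shift (- int a) (infinite_sum \<pi>) (int i)"
  proof (cases "i \<le> n - a")
    case True
    moreover have "a \<le> snd \<pi> (i + a)"
      using assms(3)[unfolded is_cut_def, rule_format, of "i + a"] x(1) by simp
    moreover have "infinite_sum \<pi> (int (i + a)) = int (snd \<pi> (i + a))"
      using infinite_sum_eq[of "i + a" \<pi> 0] True assms x by (simp add: perms_iff)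
    ultimately show ?thesis
      using infinite_sum_eq[of i ?\<pi>' 0] \<pi>' x assms(1)
      by (simp add: perms_iff shift_def) (simp add: perm_sum_def perm_drop_def)
  next
    case False
    \<comment> \<open>Position \<open>i + a\<close> lies past the end of the period, in the next
      copy of \<open>\<pi>\<close>, hence the multiple 1.\<close>
    have "infinite_sum \<pi> (int (i + a - n) + 1 * int n) = int (snd \<pi> (i + a - n)) + 1 * int n"
    proof (rule infinite_sum_eq[of "i + a - n" \<pi> 1, unfolded fst_\<pi>])
      show "i + a - n \<in> {1..n}"
        using False assms(4) x by auto
    qed
    moreover have "int (i + a - n) + 1 * int n = int i + int a"
      using False by simp
    moreover have "i - (n - a) = i + a - n" "i + a - n \<le> a"
      using False assms x by auto
    ultimately show ?thesis
      using infinite_sum_eq[of i ?\<pi>' 0] \<pi>' x assms(1,4) False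
      by (simp add: perms_iff shift_def) (simp add: perm_sum_def perm_drop_def perm_take_def of_nat_diff)
  qed
  then show "infinite_sum ?\<pi>' x = shift (- int a) (infinite_sum \<pi>) x"
    using infinite_sum_add_period[OF \<pi>' assms(2), of "int i" k]
      infinite_sum_add_period[OF assms(1,2), of "int i + int a" k] x(3)
    by (simp add: shift_def algebra_simps)
qed

section \<open>Counting the shifted infinite sums\<close>

context sum_closed_class
begin

text \<open>The pairs \<open>(\<pi>, j)\<close> with \<open>j < first_cut \<pi>\<close> parametrise
  the shifted sums bijectively, \<open>-j\<close> being the last cut at or before 0. Each
  \<open>\<pi>\<close> thus contributes \<open>first_cut \<pi>\<close> of them.\<close>

lemma infinite_sum_count_eq:
  assumes "0 < n"
  shows "infinite_sum_count C n = (\<Sum>\<pi>\<in>C \<inter> perms n. first_cut \<pi>)"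
proof -
  let ?f = "\<lambda>(\<pi>, j). shift (- int j) (infinite_sum \<pi>)"
  let ?D = "SIGMA \<pi>:C \<inter> perms n. {..<first_cut \<pi>}"
  \<comment> \<open>Undoing the shift, this would be a cut of \<open>\<pi>\<close> at
    \<open>j - i\<close>, strictly between 0 and the first cut.\<close>
  have no_cut: "\<not> is_cut (shift (- int j) (infinite_sum \<pi>)) (- int i)"
    if "\<pi> \<in> C \<inter> perms n" "i < j" "j < first_cut \<pi>" for \<pi> i j
  proof -
    have le: "j - i \<le> n"
      using that first_cut(3)[of \<pi> n] assms by auto
    have eq: "- int i - (- int j) = int (j - i)"
      using that by simp
    have "\<not> is_cut (snd \<pi>) (j - i)"
      using first_cut_le[of "j - i" \<pi>] that by auto
    then show ?thesis
      using cut_infinite_sum[of \<pi> n "j - i"] le that assms unfolding cut_shift eq by auto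
  qed
  have own_cut: "is_cut (shift (- int j) (infinite_sum \<pi>)) (- int j)" if "\<pi> \<in> C \<inter> perms n" for \<pi> j
  proof -
    have "is_cut (snd \<pi>) 0"
      using that by (auto intro: is_cut_0)
    then show ?thesis
      using cut_infinite_sum[of \<pi> n 0] that assms by (simp add: cut_shift)
  qed
  have "inj_on ?f ?D"
  proof (rule inj_onI, clarify)
    fix \<pi> j \<pi>' j'
    assume h: "\<pi> \<in> C" "\<pi> \<in> perms n" "\<pi>' \<in> C" "\<pi>' \<in> perms n" "j < first_cut \<pi>" "j' < first_cut \<pi>'"
      and eq: "shift (- int j) (infinite_sum \<pi>) = shift (- int j') (infinite_sum \<pi>')"
    \<comment> \<open>The offset is recovered from the function as the least \<open>j\<close> with a
      cut at \<open>-j\<close>.\<close>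
    have "\<not> j' < j"
      using no_cut[of \<pi> j' j] own_cut[of \<pi>' j'] h unfolding eq by blast
    moreover have "\<not> j < j'"
      using no_cut[of \<pi>' j j'] own_cut[of \<pi> j] h unfolding eq by blast
    ultimately have j: "j = j'"
      by simp
    have "infinite_sum \<pi> = infinite_sum \<pi>'"
      using arg_cong[OF eq, of "shift (int j)"] unfolding shift_shift j by (simp add: shift_def fun_eq_iff)
    with j show "\<pi> = \<pi>' \<and> j = j'"
      using infinite_sum_inj h by blast
  qed
  moreover have "?f ` ?D = infinite_sum_class C n"
  proof
    show "?f ` ?D \<subseteq> infinite_sum_class C n"
      by (auto simp: infinite_sum_class_def)
    show "infinite_sum_class C n \<subseteq> ?f ` ?D"
    proof
      fix \<sigma> assume "\<sigma> \<in> infinite_sum_class C n"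
      then obtain \<pi> r where \<sigma>: "\<sigma> = shift r (infinite_sum \<pi>)" and \<pi>: "\<pi> \<in> C \<inter> perms n"
        by (auto simp: infinite_sum_class_def)
      define j where "j = (LEAST j. is_cut \<sigma> (- int j))"
      \<comment> \<open>Modulo the period the shift may be taken nonpositive. The origin of the sum
        then becomes a cut at or before 0, so the minimum defining \<open>j\<close> exists.\<close>
      have "\<sigma> = shift (- int (nat (- r mod int n))) (infinite_sum \<pi>)"
      proof -
        have "r = - (- r mod int n) + (- (- r div int n)) * int n"
          using div_mult_mod_eq[of "- r" "int n"] by (simp only: mult_minus_left)
        then show ?thesis
          using shift_infinite_sum_period[of \<pi> n "- (- r mod int n)" "- (- r div int n)"] \<pi> assms
          unfolding \<sigma> by simp
      qed
      then have ex: "\<exists>j. is_cut \<sigma> (- int j)"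
        using own_cut[OF \<pi>] by metis
      then have j: "is_cut \<sigma> (- int j)"
        unfolding j_def by (rule LeastI_ex)
      \<comment> \<open>\<open>c\<close> is the place of the last cut in the coordinates of the
        unshifted sum, and \<open>a\<close> its residue modulo \<open>n\<close>. Shifting by
        \<open>-c\<close> or by \<open>-a\<close> gives the same function.\<close>
      define c where "c = - int j - r"
      define a where "a = nat (c mod int n)"
      have a: "int a = c mod int n" "a < n"
        using assms by (auto simp: a_def nat_less_iff)
      have c: "c = int a + (c div int n) * int n"
        using a(1) div_mult_mod_eq[of c "int n"] by simp
      have sc: "shift (- c) (infinite_sum \<pi>) = shift (- int a) (infinite_sum \<pi>)"
        using shift_infinite_sum_period[of \<pi> n "- int a" "- (c div int n)"] \<pi> assms
        by (subst c) simp
      have eq: "0 - - c = - int j - r"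
        by (simp add: c_def)
      have "is_cut (shift (- int a) (infinite_sum \<pi>)) 0"
        using j unfolding \<sigma> sc[symmetric] cut_shift eq .
      then have cut_a: "is_cut (snd \<pi>) a"
        using cut_infinite_sum[of \<pi> n a] \<pi> a assms by (simp add: cut_shift)
      \<comment> \<open>The period is restarted at the cut; closure of the class keeps the rotated
        permutation inside it.\<close>
      define \<pi>' where "\<pi>' = perm_sum (perm_drop a \<pi>) (perm_take a \<pi>)"
      have \<pi>': "\<pi>' \<in> C \<inter> perms n"
        unfolding \<pi>'_def
        using perm_sum_in_class[OF perm_drop_in_class[OF \<pi> cut_a] perm_take_in_class[OF \<pi> cut_a]] a
        by simp
      have "infinite_sum \<pi>' = shift (- c) (infinite_sum \<pi>)"
        unfolding \<pi>'_def sc using infinite_sum_rotate[OF _ assms cut_a] \<pi> a by simp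
      then have \<sigma>': "\<sigma> = shift (- int j) (infinite_sum \<pi>')"
        by (simp add: \<sigma> shift_shift c_def)
      \<comment> \<open>Otherwise the end of the first component of \<open>\<pi>'\<close> would give
        a later cut still at or before 0, against the minimality of \<open>j\<close>.\<close>
      have "j < first_cut \<pi>'"
      proof (rule ccontr)
        assume "\<not> j < first_cut \<pi>'"
        then have eq: "- int (j - first_cut \<pi>') - (- int j) = int (first_cut \<pi>')"
          by simp
        have "is_cut \<sigma> (- int (j - first_cut \<pi>'))"
          unfolding \<sigma>' cut_shift eq
          using cut_infinite_sum[of \<pi>' n] first_cut[of \<pi>' n] \<pi>' assms by auto
        then have "j \<le> j - first_cut \<pi>'"
          unfolding j_def by (rule Least_le)
        then show False
          using first_cut(1)[of \<pi>' n] \<pi>' assms \<open>\<not> j < first_cut \<pi>'\<close> by auto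
      qed
      then show "\<sigma> \<in> ?f ` ?D"
        using \<sigma>' \<pi>' by (auto intro!: image_eqI[of _ _ "(\<pi>', j)"])
    qed
  qed
  ultimately have "infinite_sum_count C n = card ?D"
    unfolding infinite_sum_count_def by (metis card_image)
  then show ?thesis
    by simp
qed

lemma infinite_sum_count_rec:
  assumes "0 < n"
  shows "infinite_sum_count C n = (\<Sum>k=1..n. k * (indec_count C k * class_count C (n - k)))"
  unfolding infinite_sum_count_eq[OF assms] by (rule sum_over_first_cut[OF assms])

end

section \<open>Power series converging beyond the closed unit disc\<close>

section \<open>The renewal theorem for power series\<close>

text \<open>The counting series are real, but zeros have to be excluded in the whole complex
  disc.\<close>

definition complexify :: "real fps \<Rightarrow> complex fps" where
  "complexify A = Abs_fps (\<lambda>n. complex_of_real (fps_nth A n))"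

lemma complexify_nth [simp]: "fps_nth (complexify A) n = complex_of_real (fps_nth A n)"
  by (simp add: complexify_def)

lemma complexify_mult: "complexify (A * B) = complexify A * complexify B"
  by (rule fps_ext) (simp add: fps_mult_nth)

lemma complexify_1 [simp]: "complexify 1 = 1"
  by (rule fps_ext) simp

lemma complexify_diff: "complexify (A - B) = complexify A - complexify B"
  by (rule fps_ext) simp

lemma complexify_X [simp]: "complexify fps_X = fps_X"
  by (rule fps_ext) (simp add: fps_X_def)

lemma fps_conv_radius_complexify [simp]: "fps_conv_radius (complexify A) = fps_conv_radius A"
  unfolding fps_conv_radius_def
  by (subst (1 2) conv_radius_norm[symmetric]) simp

lemma eval_complexify_1:
  assumes "fps_conv_radius A > 1"
  shows "eval_fps (complexify A) 1 = complex_of_real (eval_fps A 1)"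
proof -
  have "(\<lambda>n. fps_nth A n * 1 ^ n) sums eval_fps A 1"
    using assms by (intro sums_eval_fps) (simp add: one_ereal_def)
  then have "(\<lambda>n. complex_of_real (fps_nth A n)) sums complex_of_real (eval_fps A 1)"
    by (simp add: sums_of_real_iff)
  then show ?thesis
    by (simp add: eval_fps_def sums_iff)
qed

text \<open>The coefficients of \<open>A / (1 - X)\<close> are the partial sums of those of
  \<open>A\<close>, and the series of \<open>A\<close> converges at 1.\<close>

lemma fps_nth_div_one_minus_X_tendsto:
  fixes A B :: "real fps"
  assumes "fps_conv_radius A > 1" and "(1 - fps_X) * B = A"
  shows "fps_nth B \<longlonglongrightarrow> eval_fps A 1"
proof -
  have "(1 - fps_X) * B = (1 - fps_X) * Abs_fps (\<lambda>n. \<Sum>i=0..n. fps_nth A i)"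
    using assms(2) fps_divide_fps_X_minus1_sum_lemma[of A] by simp
  moreover have "(1 - fps_X :: real fps) \<noteq> 0"
    by simp
  ultimately have B: "B = Abs_fps (\<lambda>n. \<Sum>i=0..n. fps_nth A i)"
    using mult_left_cancel by blast
  have "(\<lambda>n. fps_nth A n * 1 ^ n) sums eval_fps A 1"
    using assms(1) by (intro sums_eval_fps) (simp add: one_ereal_def)
  then show ?thesis
    by (simp add: B sums_def' atLeast0AtMost fps_nth_Abs_fps[abs_def])
qed

text \<open>The quotient by \<open>1 - X\<close> has a removable singularity at \<open>1\<close>: its coefficients are,
  up to sign, the tails of a series that converges geometrically.\<close>

lemma fps_conv_radius_div_one_minus_X:
  fixes A :: "real fps"
  assumes "fps_conv_radius A > 1" and "eval_fps A 1 = 0"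
  shows "fps_conv_radius (Abs_fps (\<lambda>n. \<Sum>i=0..n. fps_nth A i)) > 1"
proof -
  obtain R where R: "1 < ereal R" "ereal R < fps_conv_radius A"
    using ereal_dense2[OF assms(1)] by blast
  then have R1: "1 < R"
    by simp
  define M where "M = (\<Sum>n. \<bar>fps_nth A n * R ^ n\<bar>)"
  have sumR: "summable (\<lambda>n. \<bar>fps_nth A n * R ^ n\<bar>)"
    using norm_summable_fps[of R A] R R1 by simp
  have "(\<lambda>n. fps_nth A n * 1 ^ n) sums eval_fps A 1"
    using assms(1) by (intro sums_eval_fps) (simp add: one_ereal_def)
  then have A0: "fps_nth A sums 0"
    using assms(2) by simp
  have abs: "summable (\<lambda>n. \<bar>fps_nth A n\<bar>)"
  proof (rule summable_comparison_test'[OF sumR])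
    fix n
    show "norm \<bar>fps_nth A n\<bar> \<le> \<bar>fps_nth A n * R ^ n\<bar>"
      using R1 by (simp add: abs_mult mult_le_cancel_left1 one_le_power)
  qed
  \<comment> \<open>As the full sum is 0, a partial sum is minus its tail. Every tail term has index
    above \<open>n\<close>, so inserting its power of \<open>R\<close> gains at least the factor
    \<open>R ^ n\<close>.\<close>
  have bound: "\<bar>\<Sum>i=0..n. fps_nth A i\<bar> \<le> M / R ^ n" for n
  proof -
    have "(\<lambda>i. fps_nth A (i + Suc n)) sums (0 - (\<Sum>i<Suc n. fps_nth A i))"
      by (rule sums_split_initial_segment[OF A0])
    then have "\<bar>\<Sum>i=0..n. fps_nth A i\<bar> = \<bar>\<Sum>i. fps_nth A (i + Suc n)\<bar>"
      by (simp add: sums_iff atLeast0AtMost lessThan_Suc_atMost)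
    also have "\<dots> \<le> (\<Sum>i. \<bar>fps_nth A (i + Suc n)\<bar>)"
      by (rule summable_rabs) (use abs in \<open>subst summable_iff_shift\<close>)
    also have "\<dots> \<le> (\<Sum>i. \<bar>fps_nth A (i + Suc n) * R ^ (i + Suc n)\<bar> / R ^ n)"
    proof (rule suminf_le)
      show "\<bar>fps_nth A (i + Suc n)\<bar> \<le> \<bar>fps_nth A (i + Suc n) * R ^ (i + Suc n)\<bar> / R ^ n" for i
        using R1 mult_right_mono[OF one_le_power[of R "Suc i"], of "\<bar>fps_nth A (i + Suc n)\<bar>"]
        by (simp add: abs_mult power_add field_simps)
    next
      show "summable (\<lambda>i. \<bar>fps_nth A (i + Suc n)\<bar>)"
        by (subst summable_iff_shift) (rule abs)
      show "summable (\<lambda>i. \<bar>fps_nth A (i + Suc n) * R ^ (i + Suc n)\<bar> / R ^ n)"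
        by (rule summable_divide) (subst summable_iff_shift[of "\<lambda>i. \<bar>fps_nth A i * R ^ i\<bar>"], rule sumR)
    qed
    also have "\<dots> = (\<Sum>i. \<bar>fps_nth A (i + Suc n) * R ^ (i + Suc n)\<bar>) / R ^ n"
      by (rule suminf_divide) (subst summable_iff_shift[of "\<lambda>i. \<bar>fps_nth A i * R ^ i\<bar>"], rule sumR)
    also have "\<dots> \<le> M / R ^ n"
    proof (rule divide_right_mono)
      show "(\<Sum>i. \<bar>fps_nth A (i + Suc n) * R ^ (i + Suc n)\<bar>) \<le> M"
        unfolding M_def suminf_split_initial_segment[OF sumR, of "Suc n"]
        by (simp add: sum_nonneg)
    qed (use R1 in simp)
    finally show ?thesis .
  qed
  have "ereal R \<le> conv_radius (\<lambda>n. \<Sum>i=0..n. fps_nth A i)"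
  proof (rule conv_radius_geI_ex')
    fix r assume r: "0 < r" "ereal r < ereal R"
    have "summable (\<lambda>n. M * (r / R) ^ n)"
      using r by (intro summable_mult summable_geometric) simp
    moreover have "norm ((\<Sum>i=0..n. fps_nth A i) * of_real r ^ n) \<le> M * (r / R) ^ n" for n
      using mult_right_mono[OF bound[of n], of "r ^ n"] r
      by (simp add: abs_mult power_divide)
    ultimately show "summable (\<lambda>n. (\<Sum>i=0..n. fps_nth A i) * of_real r ^ n)"
      by (rule summable_comparison_test') 
  qed
  with R(1) have "1 < conv_radius (\<lambda>n. \<Sum>i=0..n. fps_nth A i)"
    by (rule less_le_trans)
  then show ?thesis
    by (simp add: fps_conv_radius_def fps_nth_Abs_fps[abs_def])
qed

text \<open>The closed unit disc is compact and lies in the open set where \<open>Q\<close>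
  converges and does not vanish, so some larger disc is free of zeros too.\<close>

lemma fps_conv_radius_inverse_gt_1:
  fixes Q :: "complex fps"
  assumes "fps_conv_radius Q > 1" and "\<And>z. norm z \<le> 1 \<Longrightarrow> eval_fps Q z \<noteq> 0"
  shows "fps_conv_radius (inverse Q) > 1"
proof -
  define S where "S = {z \<in> eball 0 (fps_conv_radius Q). eval_fps Q z \<in> - {0}}"
  have "open S"
    unfolding S_def using continuous_open_preimage[OF continuous_on_eval_fps, of Q "- {0}"]
    by (auto simp: vimage_def Int_def)
  moreover have "cball 0 1 \<subseteq> S"
  proof
    fix z :: complex assume "z \<in> cball 0 1"
    then have z: "norm z \<le> 1"
      by simp
    then have "ereal (norm z) < fps_conv_radius Q"
      using assms(1) by (metis ereal_less_eq(3) le_less_trans one_ereal_def)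
    with z show "z \<in> S"
      using assms(2) by (auto simp: S_def)
  qed
  ultimately obtain e where e: "e > 0" "(\<Union>x\<in>cball 0 1. ball x e) \<subseteq> S"
    using compact_subset_open_imp_ball_epsilon_subset[OF compact_cball] by metis
  have nz: "eval_fps Q z \<noteq> 0" if "ereal (norm z) < ereal (1 + e)" for z
  proof (cases "norm z \<le> 1")
    case True
    then show ?thesis
      using assms(2) by simp
  next
    case False
    \<comment> \<open>For \<open>z\<close> outside the unit disc, the point \<open>sgn z\<close> on
      the circle is at distance \<open>norm z - 1 < e\<close>.\<close>
    have "dist (sgn z) z = norm ((1 - inverse (norm z)) *\<^sub>R z)"
      by (simp add: dist_norm norm_minus_commute sgn_div_norm scaleR_diff_left)
    also have "\<dots> = (1 - inverse (norm z)) * norm z"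
      using False by (simp only: norm_scaleR) (simp add: inverse_le_1_iff)
    also have "\<dots> = norm z - 1"
      using False by (simp add: left_diff_distrib, subst left_inverse) auto
    finally have "dist (sgn z) z = norm z - 1" .
    with that have "z \<in> ball (sgn z) e" and "sgn z \<in> cball 0 1"
      by (auto simp: norm_sgn)
    then have "z \<in> S"
      using e(2) by blast
    then show ?thesis
      by (simp add: S_def)
  qed
  have "1 < min (ereal (1 + e)) (fps_conv_radius Q)"
    using e(1) assms(1) by simp
  also have "\<dots> \<le> fps_conv_radius (inverse Q)"
    by (rule fps_conv_radius_inverse) (rule nz)
  finally show ?thesis .
qed

text \<open>The exponents with \<open>z ^ n = 1\<close> are multiples of the order of
  \<open>z\<close>. An order of at least 2 would divide the whole support of
  \<open>p\<close>.\<close>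

lemma common_period_eq_1:
  fixes z :: complex and p :: "nat \<Rightarrow> real"
  assumes "\<And>n. p n \<noteq> 0 \<Longrightarrow> z ^ n = 1" and "\<And>d. 2 \<le> d \<Longrightarrow> \<exists>n. p n \<noteq> 0 \<and> \<not> d dvd n"
  shows "z = 1"
proof (rule ccontr)
  assume "z \<noteq> 1"
  \<comment> \<open>An odd index is nonzero, so \<open>z\<close> has finite order and the minimum
    below exists.\<close>
  obtain m where m: "p m \<noteq> 0" "\<not> 2 dvd m"
    using assms(2)[of 2] by auto
  define d where "d = (LEAST d. 0 < d \<and> z ^ d = 1)"
  have "0 < m \<and> z ^ m = 1"
    using m assms(1) by (auto intro: Nat.gr0I)
  then have d: "0 < d \<and> z ^ d = 1"
    unfolding d_def by (rule LeastI)
  moreover have "d \<noteq> 1"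
    using d \<open>z \<noteq> 1\<close> by auto
  ultimately obtain n where n: "p n \<noteq> 0" "\<not> d dvd n"
    using assms(2)[of d] by force
  have "z ^ n = (z ^ d) ^ (n div d) * z ^ (n mod d)"
    by (simp flip: power_mult power_add)
  then have "0 < n mod d \<and> z ^ (n mod d) = 1"
    using n assms(1) d by (auto simp: dvd_eq_mod_eq_0)
  then have "d \<le> n mod d"
    unfolding d_def by (rule Least_le)
  with d show False
    using mod_less_divisor[of d n] by linarith
qed

text \<open>Equality case of the triangle inequality: subtracting the real part of
  \<open>P(z) = 1\<close> from \<open>P(1) = 1\<close> leaves nonnegative terms with sum 0. So
  \<open>Re (z ^ n) = 1\<close> on the support, and \<open>norm z \<le> 1\<close> then forces
  \<open>z ^ n = 1\<close>.\<close>

lemma aperiodic_eval_eq_1: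
  fixes P :: "real fps" and z :: complex
  assumes nonneg: "\<And>n. 0 \<le> fps_nth P n"
    and radius: "fps_conv_radius P > 1" and total: "eval_fps P 1 = 1"
    and aper: "\<And>d. 2 \<le> d \<Longrightarrow> \<exists>n. fps_nth P n \<noteq> 0 \<and> \<not> d dvd n"
    and z: "norm z \<le> 1" and eval: "eval_fps (complexify P) z = 1"
  shows "z = 1"
proof (rule common_period_eq_1[OF _ aper])
  fix n assume n: "fps_nth P n \<noteq> 0"
  have Re_le: "Re (z ^ k) \<le> 1" for k
    using complex_Re_le_cmod[of "z ^ k"] power_le_one[of "norm z" k] z by (simp add: norm_power)
  have "ereal (norm z) < fps_conv_radius P"
    using radius z by (metis ereal_less_eq(3) le_less_trans one_ereal_def)
  then have "(\<lambda>k. fps_nth (complexify P) k * z ^ k) sums 1"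
    using sums_eval_fps[of z "complexify P"] eval by simp
  from sums_Re[OF this] have "(\<lambda>k. fps_nth P k * Re (z ^ k)) sums 1"
    by simp
  moreover have "fps_nth P sums 1"
    using sums_eval_fps[of 1 P] radius total by (simp add: one_ereal_def)
  ultimately have "(\<lambda>k. fps_nth P k - fps_nth P k * Re (z ^ k)) sums (1 - 1)"
    by (intro sums_diff)
  then have s: "(\<lambda>k. fps_nth P k * (1 - Re (z ^ k))) sums 0"
    by (simp add: algebra_simps)
  have "fps_nth P n * (1 - Re (z ^ n)) = 0"
    using s nonneg Re_le suminf_eq_zero_iff[of "\<lambda>k. fps_nth P k * (1 - Re (z ^ k))"]
    by (auto simp: sums_iff)
  then have 1: "Re (z ^ n) = 1"
    using n by simp
  moreover have "norm (z ^ n) \<le> 1"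
    using power_le_one[of "norm z" n] z by (simp add: norm_power)
  ultimately show "z ^ n = 1"
    using cmod_power2[of "z ^ n"] power_le_one[of "norm (z ^ n)" 2]
    by (auto simp: complex_eq_iff)
qed

text \<open>The numerator is general because two are used: \<open>K = 1\<close> for the class, and
  \<open>K = X P'\<close> for the infinite sums.\<close>

theorem renewal:
  fixes P K :: "real fps"
  assumes nonneg: "\<And>n. 0 \<le> fps_nth P n" and P0: "fps_nth P 0 = 0"
    and radius: "fps_conv_radius P > 1" and total: "eval_fps P 1 = 1"
    and aper: "\<And>d. 2 \<le> d \<Longrightarrow> \<exists>n. fps_nth P n \<noteq> 0 \<and> \<not> d dvd n"
    and K: "fps_conv_radius K > 1"
  shows "eval_fps (fps_deriv P) 1 > 0"
    and "fps_nth (K * inverse (1 - P)) \<longlonglongrightarrow> eval_fps K 1 / eval_fps (fps_deriv P) 1"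
proof -
  define Q where "Q = Abs_fps (\<lambda>n. \<Sum>i=0..n. fps_nth (1 - P) i)"
  have Q: "(1 - fps_X) * Q = 1 - P"
    unfolding Q_def by (rule fps_divide_fps_X_minus1_sum_lemma[symmetric])
  have rad1: "fps_conv_radius (1 - P) > 1"
    using fps_conv_radius_diff[of 1 P] radius by (simp add: less_le_trans)
  have "eval_fps (1 - P) 1 = 0"
    using eval_fps_diff[of 1 1 P] radius total by (simp add: one_ereal_def)
  then have radQ: "fps_conv_radius Q > 1"
    unfolding Q_def by (rule fps_conv_radius_div_one_minus_X[OF rad1])
  have radP': "fps_conv_radius (fps_deriv P) > 1" and radQ': "fps_conv_radius (fps_deriv Q) > 1"
    using fps_conv_radius_deriv[of P] fps_conv_radius_deriv[of Q] radius radQ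
    by (auto intro: less_le_trans)
  let ?\<mu> = "eval_fps (fps_deriv P) 1"
  have radX: "fps_conv_radius (1 - fps_X :: real fps) = \<infinity>"
      "fps_conv_radius (1 - fps_X :: complex fps) = \<infinity>"
    using fps_conv_radius_diff[of 1 "fps_X :: real fps"] fps_conv_radius_diff[of 1 "fps_X :: complex fps"]
    by simp_all
  \<comment> \<open>Differentiate \<open>(1 - X) Q = 1 - P\<close> and evaluate at 1, where the term
    with \<open>Q'\<close> vanishes.\<close>
  have eval1: "eval_fps Q 1 = ?\<mu>"
  proof -
    have "fps_deriv P = Q - (1 - fps_X) * fps_deriv Q"
      using arg_cong[OF Q, of fps_deriv] by (simp add: algebra_simps)
    moreover have "eval_fps (Q - (1 - fps_X) * fps_deriv Q) 1 = eval_fps Q 1 - eval_fps ((1 - fps_X) * fps_deriv Q) 1"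
      using radQ radQ' fps_conv_radius_mult[of "1 - fps_X" "fps_deriv Q"]
      by (intro eval_fps_diff) (auto simp: one_ereal_def[symmetric] radX intro: less_le_trans)
    moreover have "eval_fps ((1 - fps_X) * fps_deriv Q) 1 = eval_fps (1 - fps_X) 1 * eval_fps (fps_deriv Q) 1"
      using radQ' by (intro eval_fps_mult) (auto simp: one_ereal_def[symmetric] radX)
    moreover have "eval_fps (1 - fps_X) (1::real) = 0"
      by (subst eval_fps_diff) auto
    ultimately show ?thesis
      by simp
  qed
  show \<mu>: "?\<mu> > 0"
  proof -
    \<comment> \<open>An odd index of the support is positive, so it survives differentiation and
      contributes a positive term.\<close>
    obtain n where n: "fps_nth P n \<noteq> 0" "\<not> 2 dvd n"
      using aper[of 2] by auto
    then obtain m where m: "n = Suc m"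
      by (cases n) auto
    have "summable (\<lambda>n. fps_nth (fps_deriv P) n * 1 ^ n)"
      using radP' by (intro summable_fps) (simp add: one_ereal_def)
    then show ?thesis
      unfolding eval_fps_def
      by (rule suminf_pos2[where i = m]) (use nonneg n m in \<open>auto simp: less_le\<close>)
  qed
  have nz: "eval_fps (complexify Q) z \<noteq> 0" if z: "norm z \<le> 1" for z
  proof (cases "z = 1")
    case True
    then show ?thesis
      using eval_complexify_1[OF radQ] eval1 \<mu> by simp
  next
    case False
    have less: "ereal (norm z) < R" if "1 < R" for R
      using that z by (metis ereal_less_eq(3) le_less_trans one_ereal_def)
    show ?thesis
    proof
      assume "eval_fps (complexify Q) z = 0"
      then have "eval_fps (complexify (1 - P)) z = 0"
        unfolding Q[symmetric] complexify_mult
        by (subst eval_fps_mult) (use less radQ radX in \<open>auto simp: complexify_diff\<close>)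
      then have "eval_fps (complexify P) z = 1"
        unfolding complexify_diff using eval_fps_diff[of z 1 "complexify P"] less radius by simp
      then show False
        using aperiodic_eval_eq_1[OF nonneg radius total aper z] False by blast
    qed
  qed
  have Q0: "fps_nth Q 0 \<noteq> 0"
    by (simp add: Q_def P0)
  \<comment> \<open>This carries the radius found for the complex inverse back to the real
    one.\<close>
  have "complexify Q * complexify (inverse Q) = 1"
    using inverse_mult_eq_1'[OF Q0] by (simp flip: complexify_mult)
  then have "inverse (complexify Q) = complexify (inverse Q)"
    by (rule fps_inverse_unique)
  then have radV: "fps_conv_radius (inverse Q) > 1"
    using fps_conv_radius_inverse_gt_1[of "complexify Q"] radQ nz by simp
  have "eval_fps Q 1 * eval_fps (inverse Q) 1 = eval_fps (Q * inverse Q) 1"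
    using radQ radV by (intro eval_fps_mult[symmetric]) (simp_all add: one_ereal_def)
  then have V1: "eval_fps (inverse Q) 1 = 1 / ?\<mu>"
    using inverse_mult_eq_1'[OF Q0] eval1 \<mu> by (simp add: field_simps)
  have "(1 - fps_X) * inverse (1 - fps_X) = (1 :: real fps)"
    by (rule inverse_mult_eq_1') simp
  moreover have "(1 - fps_X) * (K * inverse (1 - P)) =
      ((1 - fps_X) * inverse (1 - fps_X)) * (K * inverse Q)"
    unfolding Q[symmetric] fps_inverse_mult by (simp only: mult_ac)
  ultimately have "(1 - fps_X) * (K * inverse (1 - P)) = K * inverse Q"
    by simp
  moreover have "fps_conv_radius (K * inverse Q) > 1"
    using fps_conv_radius_mult[of K "inverse Q"] K radV by (metis less_le_trans min_less_iff_conj)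
  ultimately have "fps_nth (K * inverse (1 - P)) \<longlonglongrightarrow> eval_fps (K * inverse Q) 1"
    by (intro fps_nth_div_one_minus_X_tendsto)
  moreover have "eval_fps (K * inverse Q) 1 = eval_fps K 1 * eval_fps (inverse Q) 1"
    using K radV by (intro eval_fps_mult) (simp_all add: one_ereal_def)
  ultimately show "fps_nth (K * inverse (1 - P)) \<longlonglongrightarrow> eval_fps K 1 / ?\<mu>"
    by (simp add: V1)
qed

section \<open>Rescaling, and the root of G = 1\<close>

definition rescale :: "real \<Rightarrow> real fps \<Rightarrow> real fps" where
  "rescale \<rho> A = Abs_fps (\<lambda>n. fps_nth A n * \<rho> ^ n)"

lemma rescale_nth [simp]: "fps_nth (rescale \<rho> A) n = fps_nth A n * \<rho> ^ n"
  by (simp add: rescale_def)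

lemma rescale_mult: "rescale \<rho> (A * B) = rescale \<rho> A * rescale \<rho> B"
proof (rule fps_ext)
  fix n
  have "\<rho> ^ n = \<rho> ^ i * \<rho> ^ (n - i)" if "i \<in> {0..n}" for i
    using that by (simp flip: power_add)
  then show "fps_nth (rescale \<rho> (A * B)) n = fps_nth (rescale \<rho> A * rescale \<rho> B) n"
    by (auto simp: fps_mult_nth sum_distrib_right intro!: sum.cong)
qed

lemma rescale_1_minus: "rescale \<rho> (1 - A) = 1 - rescale \<rho> A"
  by (rule fps_ext) (simp add: algebra_simps)

lemma eval_rescale: "eval_fps (rescale \<rho> A) 1 = eval_fps A \<rho>"
  by (simp add: eval_fps_def)

lemma fps_conv_radius_rescale:
  assumes "\<rho> > 0" and "ereal \<rho> < fps_conv_radius A"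
  shows "fps_conv_radius (rescale \<rho> A) > 1"
proof -
  obtain x where x: "ereal \<rho> < ereal x" "ereal x < fps_conv_radius A"
    using ereal_dense2[OF assms(2)] by blast
  then have "summable (\<lambda>n. fps_nth A n * x ^ n)"
    using assms(1) by (intro summable_fps) simp
  then have "summable (\<lambda>n. fps_nth (rescale \<rho> A) n * (x / \<rho>) ^ n)"
    using assms(1) by (simp add: power_divide)
  from conv_radius_geI[OF this] have "ereal (x / \<rho>) \<le> fps_conv_radius (rescale \<rho> A)"
    using x assms(1) by (simp add: fps_conv_radius_def)
  moreover have "1 < ereal (x / \<rho>)"
    using x assms(1) by simp
  ultimately show ?thesis
    by (rule less_le_trans[rotated])
qed

lemma eval_deriv_rescale:
  assumes "\<rho> > 0" and "ereal \<rho> < fps_conv_radius A"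
  shows "eval_fps (fps_deriv (rescale \<rho> A)) 1 = \<rho> * eval_fps (fps_deriv A) \<rho>"
proof -
  have "(\<lambda>n. fps_nth (fps_deriv A) n * \<rho> ^ n) sums eval_fps (fps_deriv A) \<rho>"
    using assms fps_conv_radius_deriv[of A] by (intro sums_eval_fps) (auto intro: less_le_trans)
  from sums_mult[OF this, of \<rho>] show ?thesis
    by (simp add: eval_fps_def sums_iff mult_ac)
qed

text \<open>For \<open>x < y\<close> the termwise differences are nonnegative with sum 0, so every
  coefficient vanishes, contradicting the total 1. Using \<open>sums\<close> includes convergence,
  so points where the series diverges are excluded as roots.\<close>

lemma power_series_root_unique:
  fixes g :: "nat \<Rightarrow> real"
  assumes nonneg: "\<And>n. 0 \<le> g n" and g0: "g 0 = 0"
    and "x > 0" "(\<lambda>n. g n * x ^ n) sums 1" and "y > 0" "(\<lambda>n. g n * y ^ n) sums 1"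
  shows "x = y"
proof -
  have *: False if "0 < x" "x < y" "(\<lambda>n. g n * x ^ n) sums 1" "(\<lambda>n. g n * y ^ n) sums 1" for x y
  proof -
    have "(\<lambda>n. g n * y ^ n - g n * x ^ n) sums 0"
      using sums_diff[OF that(4,3)] by simp
    moreover have "0 \<le> g n * y ^ n - g n * x ^ n" for n
      using that nonneg by (simp add: mult_left_mono power_mono)
    ultimately have "g n * y ^ n - g n * x ^ n = 0" for n
      using suminf_eq_zero_iff[of "\<lambda>n. g n * y ^ n - g n * x ^ n"] by (simp add: sums_iff)
    moreover have "x ^ n \<noteq> y ^ n" if "0 < n" for n
      using power_strict_mono[of x y n] \<open>0 < x\<close> \<open>x < y\<close> that by simp
    ultimately have "g n = 0" for n
      using g0 by (cases "n = 0") (metis mult_cancel_left eq_iff_diff_eq_0 neq0_conv)+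
    then show False
      using that(3) sums_unique2[OF sums_zero] by fastforce
  qed
  show ?thesis
    using *[of x y] *[of y x] assms by (meson linorder_neqE_linordered_idom)
qed

text \<open>Since \<open>\<tau> > 1\<close>, \<open>G\<close> exceeds 1 at some \<open>x\<close>
  strictly below \<open>r\<close>, and the intermediate value theorem applies on
  \<open>[0, x]\<close>. The strict bound \<open>\<rho> < r\<close> is what makes the rescaled
  series converge beyond the unit disc.\<close>

lemma supercritical_root:
  fixes G :: "real fps" and r \<tau> :: ereal
  assumes G0: "fps_nth G 0 = 0" and r: "r = fps_conv_radius G" "r > 0"
    and lim: "((\<lambda>x::ereal. ereal (eval_fps G (real_of_ereal x))) \<longlongrightarrow> \<tau>) (at_left r)"
    and \<tau>: "\<tau> > 1"
  obtains \<rho> where "\<rho> > 0" "ereal \<rho> < r" "eval_fps G \<rho> = 1"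
proof -
  have "\<forall>\<^sub>F x in at_left r. 1 < ereal (eval_fps G (real_of_ereal x))"
    using order_tendstoD(1)[OF lim \<tau>] .
  then obtain b where b: "b < r" "\<And>x. b < x \<Longrightarrow> x < r \<Longrightarrow> 1 < ereal (eval_fps G (real_of_ereal x))"
    unfolding eventually_at_left[OF r(2)] by auto
  have "max b 0 < r"
    using b r by simp
  then obtain x where x: "max b 0 < ereal x" "ereal x < r"
    using ereal_dense2 by blast
  then have x0: "0 < x" and x1: "1 < eval_fps G x"
    using b(2)[of "ereal x"] by auto
  have "continuous_on {0..x} (eval_fps G)"
  proof (rule continuous_on_subset[OF continuous_on_eval_fps], rule subsetI)
    fix y assume "y \<in> {0..x}"
    then have "ereal (norm y) \<le> ereal x"
      by simp
    with x(2) show "y \<in> eball 0 (fps_conv_radius G)"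
      unfolding r(1) by (auto intro: le_less_trans[of _ "ereal x"])
  qed
  then obtain \<rho> where \<rho>: "0 \<le> \<rho>" "\<rho> \<le> x" "eval_fps G \<rho> = 1"
    using IVT'[of "eval_fps G" 0 1 x] x0 x1 G0 by (auto simp: eval_fps_at_0)
  moreover have "\<rho> \<noteq> 0"
    using \<rho>(3) G0 by (auto simp: eval_fps_at_0)
  ultimately show ?thesis
    using that[of \<rho>] x(2) by (simp add: le_less_trans[of "ereal \<rho>" "ereal x"])
qed

text \<open>If \<open>d\<close> divided every exponent, \<open>G\<close> would be a series in
  \<open>X ^ d\<close>, with \<open>s = 0\<close> and the coefficients of \<open>G\<close> at the
  multiples of \<open>d\<close>.\<close>

lemma aperiodicD:
  assumes "aperiodic G" and "2 \<le> d"
  shows "\<exists>n. fps_nth G n \<noteq> 0 \<and> \<not> d dvd n"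
proof (rule ccontr)
  assume *: "\<not> ?thesis"
  have "G = fps_X ^ 0 * (Abs_fps (\<lambda>n. fps_nth G (n * d)) oo fps_X ^ d)"
    using * by (intro fps_ext) (auto simp: fps_nth_compose_X_power)
  then show False
    using assms unfolding aperiodic_def by blast
qed

section \<open>Series identities and the limits\<close>

section \<open>Generating functions and asymptotics\<close>

context sum_closed_class
begin

text \<open>The recursion by first component is \<open>F = 1 + G F\<close> in coefficients;
  nonemptiness supplies the constant term 1.\<close>

lemma class_gf_eq:
  assumes "C \<noteq> {}"
  shows "class_gf C = inverse (1 - indec_gf C)"
proof (rule fps_inverse_unique[symmetric])
  have "class_gf C = 1 + indec_gf C * class_gf C"
  proof (rule fps_ext)
    fix n
    show "fps_nth (class_gf C) n = fps_nth (1 + indec_gf C * class_gf C) n"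
    proof (cases "n = 0")
      case True
      then show ?thesis
        using class_count_0[OF assms] by (simp add: class_gf_def indec_gf_def)
    next
      case False
      have "fps_nth (indec_gf C * class_gf C) n =
          (\<Sum>k=1..n. fps_nth (indec_gf C) k * fps_nth (class_gf C) (n - k))"
        unfolding fps_mult_nth by (intro sum.mono_neutral_right) (auto simp: indec_gf_def)
      then show ?thesis
        using False class_count_rec[of n] by (simp add: class_gf_def indec_gf_def)
    qed
  qed
  then show "(1 - indec_gf C) * class_gf C = 1"
    by (simp add: algebra_simps)
qed

text \<open>The factor \<open>k\<close>, one for each offset within the first component, turns
  \<open>G\<close> into \<open>X G'\<close>.\<close>

lemma infinite_sum_count_gf:
  assumes "0 < n"
  shows "real (infinite_sum_count C n) = fps_nth (fps_X * fps_deriv (indec_gf C) * class_gf C) n"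
proof -
  have nth: "fps_nth (fps_X * fps_deriv (indec_gf C)) k = real k * fps_nth (indec_gf C) k" for k
    by (cases k) simp_all
  have "fps_nth (fps_X * fps_deriv (indec_gf C) * class_gf C) n =
      (\<Sum>k=1..n. fps_nth (fps_X * fps_deriv (indec_gf C)) k * fps_nth (class_gf C) (n - k))"
    unfolding fps_mult_nth[of "fps_X * fps_deriv (indec_gf C)"] nth
    by (intro sum.mono_neutral_right) auto
  then show ?thesis
    unfolding nth using infinite_sum_count_rec[OF assms]
    by (simp add: class_gf_def indec_gf_def mult.assoc)
qed

end

lemma asymp_equiv_powi:
  fixes f :: "nat \<Rightarrow> real"
  assumes "\<rho> > 0" and "(\<lambda>n. f n * \<rho> ^ n) \<longlonglongrightarrow> 1"
  shows "f \<sim>[sequentially] (\<lambda>n. \<rho> powi (- int n))"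
proof (rule asymp_equivI')
  show "(\<lambda>n. f n / \<rho> powi (- int n)) \<longlonglongrightarrow> 1"
    using assms by (simp add: power_int_minus divide_inverse)
qed

text \<open>Ratio test: because \<open>c\<close> is nonzero, quotients of consecutive coefficients
  are eventually defined and tend to \<open>\<rho>\<close>.\<close>

lemma fps_conv_radius_eqI_tendsto:
  fixes A :: "real fps"
  assumes "\<rho> > 0" and "c \<noteq> 0" and lim: "(\<lambda>n. fps_nth A n * \<rho> ^ n) \<longlonglongrightarrow> c"
  shows "fps_conv_radius A = ereal \<rho>"
proof -
  have nz: "\<forall>\<^sub>F n in sequentially. fps_nth A n \<noteq> 0"
    using tendsto_imp_eventually_ne[OF lim assms(2)] by eventually_elim auto
  have "(\<lambda>n. fps_nth A n * \<rho> ^ n / (fps_nth A (Suc n) * \<rho> ^ Suc n) * \<rho>) \<longlonglongrightarrow> c / c * \<rho>"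
    by (intro tendsto_intros lim LIMSEQ_Suc[OF lim] assms(2))
  then have "(\<lambda>n. \<bar>fps_nth A n / fps_nth A (Suc n)\<bar>) \<longlonglongrightarrow> \<bar>\<rho>\<bar>"
    using assms(1,2) by (intro tendsto_rabs) simp
  then have "(\<lambda>n. ereal (norm (fps_nth A n) / norm (fps_nth A (Suc n)))) \<longlonglongrightarrow> ereal \<rho>"
    using assms(1) by simp
  with nz show ?thesis
    unfolding fps_conv_radius_def by (intro conv_radius_ratio_limit_ereal)
qed

theorem theorem4p4:
  fixes C :: "fperm set" and r \<tau> :: ereal
  assumes "permutation_class C"
    and "sum_closed C"
    and "r = fps_conv_radius (indec_gf C)"
    and "r > 0"
    and "((\<lambda>x::ereal. ereal (eval_fps (indec_gf C) (real_of_ereal x))) \<longlongrightarrow> \<tau>) (at_left r)"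
    and "\<tau> > 1"
    and "aperiodic (indec_gf C)"
  shows "\<exists>\<rho> \<alpha> :: real. \<rho> > 0 \<and>
      (\<forall>x>0. (\<lambda>n. fps_nth (indec_gf C) n * x ^ n) sums 1 \<longleftrightarrow> x = \<rho>) \<and>
      class_gf C = inverse (1 - indec_gf C) \<and>
      fps_conv_radius (class_gf C) = ereal \<rho> \<and>
      inverse \<alpha> = \<rho> * eval_fps (fps_deriv (indec_gf C)) \<rho> \<and>
      (\<lambda>n. real (infinite_sum_count C n)) \<sim>[sequentially] (\<lambda>n. inverse \<alpha> * real (class_count C n)) \<and>
      (\<lambda>n. inverse \<alpha> * real (class_count C n)) \<sim>[sequentially] (\<lambda>n. \<rho> powi (- int n))"
proof -
  interpret sum_closed_class C
    by unfold_locales (fact assms)+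
  let ?G = "indec_gf C" and ?F = "class_gf C"
  have nonneg: "0 \<le> fps_nth ?G n" and G0: "fps_nth ?G 0 = 0" for n
    by (simp_all add: indec_gf_def)
  obtain \<rho> where \<rho>: "\<rho> > 0" "ereal \<rho> < r" "eval_fps ?G \<rho> = 1"
    using supercritical_root[OF G0 assms(3-6)] .
  have \<rho>_rad: "ereal \<rho> < fps_conv_radius ?G"
    using \<rho>(2) assms(3) by simp
  have root: "(\<lambda>n. fps_nth ?G n * \<rho> ^ n) sums 1"
    using sums_eval_fps[of \<rho> ?G] \<rho> \<rho>_rad by simp
  \<comment> \<open>For the empty class \<open>G\<close> is 0 and never takes the value 1.\<close>
  have "C \<noteq> {}"
  proof
    assume "C = {}"
    then have "?G = 0"
      by (intro fps_ext) (simp add: indec_gf_def indec_count_def)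
    then show False
      using \<rho>(3) by simp
  qed
  then have F: "?F = inverse (1 - ?G)"
    by (rule class_gf_eq)
  \<comment> \<open>The coefficients of \<open>P\<close> form a probability distribution with mean
    \<open>\<mu>\<close>, which is the inverse of the sought \<open>\<alpha>\<close>.\<close>
  define P where "P = rescale \<rho> ?G"
  define \<mu> where "\<mu> = eval_fps (fps_deriv P) 1"
  have \<mu>: "\<mu> = \<rho> * eval_fps (fps_deriv ?G) \<rho>"
    unfolding \<mu>_def P_def by (rule eval_deriv_rescale[OF \<rho>(1) \<rho>_rad])
  have radP: "fps_conv_radius P > 1"
    unfolding P_def by (rule fps_conv_radius_rescale[OF \<rho>(1) \<rho>_rad])
  have "rescale \<rho> (1 - ?G) * rescale \<rho> ?F = rescale \<rho> ((1 - ?G) * ?F)"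
    by (rule rescale_mult[symmetric])
  also have "(1 - ?G) * ?F = 1"
    unfolding F by (rule inverse_mult_eq_1') (simp add: G0)
  also have "rescale \<rho> 1 = 1"
    by (rule fps_ext) simp
  finally have U: "inverse (1 - P) = rescale \<rho> ?F"
    unfolding P_def rescale_1_minus by (rule fps_inverse_unique)
  have aper: "\<exists>n. fps_nth P n \<noteq> 0 \<and> \<not> d dvd n" if "2 \<le> d" for d
    using aperiodicD[OF assms(7) that] \<rho>(1) by (simp add: P_def)
  note renewal = renewal[of P, OF _ _ radP _ aper, folded \<mu>_def]
  have P: "0 \<le> fps_nth P n" "fps_nth P 0 = 0" "eval_fps P 1 = 1" for n
    using nonneg \<rho> G0 by (simp_all add: P_def eval_rescale)
  have \<mu>_pos: "\<mu> > 0"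
    using renewal(1)[of 1] P by simp
  \<comment> \<open>The case \<open>K = 1\<close>.\<close>
  have "fps_nth (1 * inverse (1 - P)) \<longlonglongrightarrow> eval_fps 1 1 / \<mu>"
    by (rule renewal(2)) (use P in auto)
  then have lim_F: "(\<lambda>n. real (class_count C n) * \<rho> ^ n) \<longlonglongrightarrow> 1 / \<mu>"
    unfolding U by (simp add: class_gf_def rescale_def fps_nth_Abs_fps[abs_def])
  have radK: "fps_conv_radius (fps_X * fps_deriv P) > 1"
    using fps_conv_radius_mult[of fps_X "fps_deriv P"] fps_conv_radius_deriv[of P] radP
    by (auto intro: less_le_trans)
  \<comment> \<open>For \<open>K = X P'\<close> the numerator at 1 equals the mean, so the limit is
    exactly 1.\<close>
  have "eval_fps (fps_X * fps_deriv P) 1 = \<mu>"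
    using fps_conv_radius_deriv[of P] radP
    by (subst eval_fps_mult) (auto simp: \<mu>_def one_ereal_def[symmetric] intro: less_le_trans)
  moreover have "fps_nth (fps_X * fps_deriv P * inverse (1 - P)) \<longlonglongrightarrow>
      eval_fps (fps_X * fps_deriv P) 1 / \<mu>"
    by (rule renewal(2)) (use P radK in auto)
  moreover have "fps_X * fps_deriv P = rescale \<rho> (fps_X * fps_deriv ?G)"
  proof (rule fps_ext)
    show "fps_nth (fps_X * fps_deriv P) n = fps_nth (rescale \<rho> (fps_X * fps_deriv ?G)) n" for n
      by (cases n) (simp_all add: P_def)
  qed
  ultimately have "(\<lambda>n. fps_nth (fps_X * fps_deriv ?G * ?F) n * \<rho> ^ n) \<longlonglongrightarrow> 1"
    using \<mu>_pos unfolding U by (simp flip: rescale_mult) (simp add: rescale_def fps_nth_Abs_fps[abs_def])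
  moreover have "\<forall>\<^sub>F n in sequentially. fps_nth (fps_X * fps_deriv ?G * ?F) n * \<rho> ^ n =
      real (infinite_sum_count C n) * \<rho> ^ n"
    using eventually_gt_at_top[of 0] by eventually_elim (simp add: infinite_sum_count_gf)
  ultimately have lim_T: "(\<lambda>n. real (infinite_sum_count C n) * \<rho> ^ n) \<longlonglongrightarrow> 1"
    by (rule Lim_transform_eventually)
  have T: "(\<lambda>n. real (infinite_sum_count C n)) \<sim>[sequentially] (\<lambda>n. \<rho> powi (- int n))"
    by (rule asymp_equiv_powi[OF \<rho>(1) lim_T])
  have "(\<lambda>n. \<mu> * (real (class_count C n) * \<rho> ^ n)) \<longlonglongrightarrow> \<mu> * (1 / \<mu>)"
    by (intro tendsto_intros lim_F)
  then have F': "(\<lambda>n. \<mu> * real (class_count C n)) \<sim>[sequentially] (\<lambda>n. \<rho> powi (- int n))"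
    using \<mu>_pos by (intro asymp_equiv_powi \<rho>) (simp add: mult.assoc)
  have rad_F: "fps_conv_radius ?F = ereal \<rho>"
    using fps_conv_radius_eqI_tendsto[of \<rho> "1 / \<mu>" ?F] \<rho> \<mu>_pos lim_F by (simp add: class_gf_def)
  have root_iff: "\<forall>x>0. (\<lambda>n. fps_nth ?G n * x ^ n) sums 1 \<longleftrightarrow> x = \<rho>"
    using power_series_root_unique[of "fps_nth ?G", OF nonneg G0] \<rho>(1) root by blast
  show ?thesis
  \<comment> \<open>The witness for \<open>\<alpha>\<close> is \<open>inverse \<mu>\<close>, fixed
    by unification with the first \<open>show\<close>.\<close>
  proof (intro exI conjI)
    show "inverse (inverse \<mu>) = \<rho> * eval_fps (fps_deriv ?G) \<rho>"
      using \<mu> by simp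
    show "(\<lambda>n. real (infinite_sum_count C n)) \<sim>[sequentially]
        (\<lambda>n. inverse (inverse \<mu>) * real (class_count C n))"
      using asymp_equiv_trans[OF T asymp_equiv_symI[OF F']] by simp
    show "(\<lambda>n. inverse (inverse \<mu>) * real (class_count C n)) \<sim>[sequentially] (\<lambda>n. \<rho> powi (- int n))"
      using F' by simp
  qed (fact \<rho>(1) root_iff F rad_F)+
qed

end
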